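(* Let $G\le S_N$ be a permutation group acting on $\mathbb{R}^N$ by coordinate permutations. Let $\mathcal{F}=(f_1,\dots,f_k)$ be a finite tuple of $G$-invariant tropical rational functions on $\mathbb{R}^N$ such that: (S) the map $\Phi_{\mathcal{F}}:\mathbb{R}^N\to\mathbb{R}^k$, $x\mapsto(f_1(x),\dots,f_k(x))$, separates $G$-orbits and satisfies $\|\Phi_{\mathcal{F}}(x)-\Phi_{\mathcal{F}}(y)\|_2\ge c_{\mathcal{F}}\,d([x],[y])$ for all $x,y\in\mathbb{R}^N$, for some constant $c_{\mathcal{F}}>0$ (the map $\Phi_{\mathcal{F}}$ is then in fact bi-Lipschitz, the upper Lipschitz bound being automatic); (T) there are a finite index set $J$ and componentwise tropical rational maps $T_j:\mathbb{R}^k\to\mathbb{R}^N$, $j\in J$, such that every $x\in\mathbb{R}^N$ satisfies $[T_j(\Phi_{\mathcal{F}}(x))]=[x]$ for at least one $j\in J$. Then $\mathcal{F}$ generates the semifield of $G$-invariant tropical rational functions on $\mathbb{R}^N$: for every $G$-invariant tropical rational function $f$ on $\mathbb{R}^N$ and every sufficiently large integer $\kappa_f$, $$f=\Bigl(\min_{j\in J}\bigl[f\circ T_j+\kappa_f\,D_j\bigr]\Bigr)\circ\Phi_{\mathcal{F}},\qquad D_j(w):=\max_{1\le i\le k}\bigl|w_i-f_i(T_j(w))\bigr|.$$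
   Context: $[x]$ denotes the $G$-orbit of $x\in\mathbb{R}^N$, and $d([x],[y])=\min_{g\in G}\|x-g\cdot y\|_2$ is the quotient metric. A map separates $G$-orbits if it takes different values at points in different orbits. A tropical polynomial on $\mathbb{R}^m$ is a finite maximum of functions $z\mapsto\gamma+\sum_i a_iz_i$ with $\gamma\in\mathbb{R}$, $a\in\mathbb{Z}_{\ge0}^m$; a tropical rational function is a difference of two tropical polynomials, regarded as a function. These form a semifield under $\max$ (addition), $+$ (multiplication), $-$ (division). A map $\mathbb{R}^p\to\mathbb{R}^m$ is componentwise tropical rational if each of its $m$ components is a tropical rational function on $\mathbb{R}^p$. The tuple $\mathcal{F}$ generates the semifield of $G$-invariant tropical rational functions if every $G$-invariant tropical rational $f$ equals $g\circ\Phi_{\mathcal{F}}$ for some tropical rational $g$ on $\mathbb{R}^k$. *)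

theory Defs
  imports "HOL-Analysis.Analysis" "HOL-Algebra.Bij"
begin

text \<open>
  Coordinates of \<open>\<real>\<^sup>N\<close> are indexed by a finite type \<open>'n\<close>. A permutation group on them is
  a set \<open>G\<close> with \<open>subgroup G (BijGroup UNIV)\<close>, where \<open>BijGroup UNIV\<close> is the symmetric group
  on \<open>'n\<close>.
\<close>

text \<open>
  The inverse makes this a left action. It is written \<open>inv_into UNIV\<close> because HOL-Algebra
  takes over the notation \<open>inv\<close>.
\<close>

definition perm_act :: "('n::finite \<Rightarrow> 'n) \<Rightarrow> real ^ 'n \<Rightarrow> real ^ 'n" where
  "perm_act g x = (\<chi> i. x $ inv_into UNIV g i)"

definition perm_orbit :: "('n::finite \<Rightarrow> 'n) set \<Rightarrow> real ^ 'n \<Rightarrow> (real ^ 'n) set" where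
  "perm_orbit G x = (\<lambda>g. perm_act g x) ` G"

text \<open>The quotient metric \<open>d([x],[y])\<close>, as a function of representatives.\<close>

definition orbit_dist :: "('n::finite \<Rightarrow> 'n) set \<Rightarrow> real ^ 'n \<Rightarrow> real ^ 'n \<Rightarrow> real" where
  "orbit_dist G x y = (MIN g\<in>G. norm (x - perm_act g y))"

definition perm_invariant :: "('n::finite \<Rightarrow> 'n) set \<Rightarrow> (real ^ 'n \<Rightarrow> real) \<Rightarrow> bool" where
  "perm_invariant G f \<longleftrightarrow> (\<forall>g\<in>G. \<forall>x. f (perm_act g x) = f x)"

definition separates_orbits :: "('n::finite \<Rightarrow> 'n) set \<Rightarrow> (real ^ 'n \<Rightarrow> 'b) \<Rightarrow> bool" where
  "separates_orbits G F \<longleftrightarrow> (\<forall>x y. perm_orbit G x \<noteq> perm_orbit G y \<longrightarrow> F x \<noteq> F y)"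

text \<open>
  A pair \<open>(\<gamma>, a)\<close> encodes the tropical monomial with coefficient \<open>\<gamma>\<close> and exponent vector \<open>a\<close>.
  The set of monomials is nonempty: all functions are real-valued, with no element
  \<open>-\<infinity>\<close>.
\<close>

definition tropical_monomial :: "real \<times> ('m::finite \<Rightarrow> nat) \<Rightarrow> real ^ 'm \<Rightarrow> real" where
  "tropical_monomial t z = fst t + (\<Sum>i\<in>UNIV. real (snd t i) * z $ i)"

definition tropical_polynomial :: "(real ^ 'm::finite \<Rightarrow> real) \<Rightarrow> bool" where
  "tropical_polynomial p \<longleftrightarrow>
     (\<exists>S. finite S \<and> S \<noteq> {} \<and> p = (\<lambda>z. MAX t\<in>S. tropical_monomial t z))"

definition tropical_rational :: "(real ^ 'm::finite \<Rightarrow> real) \<Rightarrow> bool" where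
  "tropical_rational f \<longleftrightarrow>
     (\<exists>p q. tropical_polynomial p \<and> tropical_polynomial q \<and> f = (\<lambda>z. p z - q z))"

definition tropical_rational_map :: "(real ^ 'p::finite \<Rightarrow> real ^ 'm::finite) \<Rightarrow> bool" where
  "tropical_rational_map T \<longleftrightarrow> (\<forall>i. tropical_rational (\<lambda>z. T z $ i))"

definition tuple_map :: "('k::finite \<Rightarrow> real ^ 'n::finite \<Rightarrow> real) \<Rightarrow> real ^ 'n \<Rightarrow> real ^ 'k" where
  "tuple_map F x = (\<chi> i. F i x)"

definition generates_invariants ::
    "('n::finite \<Rightarrow> 'n) set \<Rightarrow> ('k::finite \<Rightarrow> real ^ 'n \<Rightarrow> real) \<Rightarrow> bool" where
  "generates_invariants G F \<longleftrightarrow>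
     (\<forall>f. tropical_rational f \<and> perm_invariant G f \<longrightarrow>
        (\<exists>g. tropical_rational g \<and> f = g \<circ> tuple_map F))"

text \<open>The function \<open>D\<^sub>j\<close>, for \<open>T = T\<^sub>j\<close>.\<close>

definition defect ::
    "('k::finite \<Rightarrow> real ^ 'n::finite \<Rightarrow> real) \<Rightarrow> (real ^ 'k \<Rightarrow> real ^ 'n) \<Rightarrow> real ^ 'k \<Rightarrow> real" where
  "defect F T w = (MAX i\<in>UNIV. \<bar>w $ i - F i (T w)\<bar>)"

text \<open>The function \<open>min\<^sub>j [f \<circ> T\<^sub>j + \<kappa> D\<^sub>j]\<close> on \<open>\<real>\<^sup>k\<close>.\<close>

definition min_formula ::
    "('k::finite \<Rightarrow> real ^ 'n::finite \<Rightarrow> real) \<Rightarrow> 'j set \<Rightarrow> ('j \<Rightarrow> real ^ 'k \<Rightarrow> real ^ 'n) \<Rightarrow>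
      (real ^ 'n \<Rightarrow> real) \<Rightarrow> int \<Rightarrow> real ^ 'k \<Rightarrow> real" where
  "min_formula F J T f \<kappa> w = (MIN j\<in>J. f (T j w) + of_int \<kappa> * defect F (T j) w)"

end

theory Submission
  imports Defs
begin

text \<open>
  Two properties of tropical rational functions carry the proof. They form the smallest set of
  functions that contains the constants and the coordinates and is closed under sums,
  differences and binary maxima (\<open>tropical_rational_induct\<close>). Hence, by induction, they are
  Lipschitz, and they are closed under composition with componentwise tropical rational maps.

  An invariant Lipschitz function is Lipschitz for the quotient metric \<open>d\<close>, because a
  representative of \<open>[y]\<close> may be moved to the point of its orbit nearest to \<open>x\<close>. For the \<open>f\<^sub>i\<close>
  this is the upper bound on \<open>\<Phi>\<close>.

  The formula is an exact penalty argument (\<open>min_formula_tuple_map\<close>). Put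
  \<open>w = \<Phi> x\<close> and \<open>y = T\<^sub>j w\<close>. Then \<open>D\<^sub>j w\<close> is the maximum norm of \<open>\<Phi> x - \<Phi> y\<close>, so the lower
  bound in hypothesis (S) gives \<open>c \<cdot> d([x],[y]) \<le> k \<cdot> D\<^sub>j w\<close>. If \<open>L\<close> is a Lipschitz constant of \<open>f\<close> for \<open>d\<close>, then
  \<open>f x - f y \<le> L \<cdot> d([x],[y]) \<le> (L k / c) \<cdot> D\<^sub>j w\<close>. Hence once \<open>\<kappa> \<ge> L k / c\<close>, no term of the
  minimum is below \<open>f x\<close>. For the \<open>j\<close> with \<open>[T\<^sub>j w] = [x]\<close> given by hypothesis (T), the penalty
  vanishes and the term equals \<open>f x\<close>. The minimum is itself tropical rational, so the formula
  shows that \<open>\<F>\<close> generates.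
\<close>

section \<open>Tropical rational functions\<close>

lemma tropical_polynomial_const: "tropical_polynomial (\<lambda>z::real^'m::finite. c)"
  unfolding tropical_polynomial_def
  by (rule exI[of _ "{(c, \<lambda>_. 0)}"]) (simp add: tropical_monomial_def)

lemma tropical_polynomial_coordinate: "tropical_polynomial (\<lambda>z::real^'m::finite. z $ i)"
proof -
  have "real (if j = i then 1 else 0) * (z::real^'m) $ j = (if j = i then z $ j else 0)" for z j
    by simp
  then have "tropical_monomial (0, \<lambda>j. if j = i then 1 else 0) z = z $ i" for z :: "real^'m"
    by (simp add: tropical_monomial_def)
  then show ?thesis
    unfolding tropical_polynomial_def
    by (intro exI[of _ "{(0, \<lambda>j. if j = i then 1 else 0)}"]) simp
qed

text \<open>The product of two tropical polynomials is expanded by distributivity of \<open>+\<close> over \<open>max\<close>.\<close>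

lemma tropical_polynomial_add:
  fixes p q :: "real^'m::finite \<Rightarrow> real"
  assumes "tropical_polynomial p" "tropical_polynomial q"
  shows "tropical_polynomial (\<lambda>z. p z + q z)"
proof -
  obtain A where A: "finite A" "A \<noteq> {}" and p: "p = (\<lambda>z. MAX t\<in>A. tropical_monomial t z)"
    using assms(1) unfolding tropical_polynomial_def by blast
  obtain B where B: "finite B" "B \<noteq> {}" and q: "q = (\<lambda>z. MAX t\<in>B. tropical_monomial t z)"
    using assms(2) unfolding tropical_polynomial_def by blast
  define m :: "(real \<times> ('m \<Rightarrow> nat)) \<times> (real \<times> ('m \<Rightarrow> nat)) \<Rightarrow> real \<times> ('m \<Rightarrow> nat)"
    where "m = (\<lambda>(s, t). (fst s + fst t, \<lambda>i. snd s i + snd t i))"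
  have m: "tropical_monomial (m (s, t)) z = tropical_monomial s z + tropical_monomial t z"
    for s t z
    by (simp add: tropical_monomial_def m_def algebra_simps sum.distrib)
  have "p z + q z = (MAX t\<in>m ` (A \<times> B). tropical_monomial t z)" for z
  proof (rule sym, rule Max_eqI)
    show "finite ((\<lambda>t. tropical_monomial t z) ` m ` (A \<times> B))"
      using A B by simp
  next
    fix v assume "v \<in> (\<lambda>t. tropical_monomial t z) ` m ` (A \<times> B)"
    then obtain s t where st: "s \<in> A" "t \<in> B" "v = tropical_monomial (m (s, t)) z"
      by auto
    then have "tropical_monomial s z \<le> p z" "tropical_monomial t z \<le> q z"
      using A B by (simp_all add: p q)
    then show "v \<le> p z + q z"
      using st by (simp add: m)
  next
    have "p z \<in> (\<lambda>t. tropical_monomial t z) ` A" "q z \<in> (\<lambda>t. tropical_monomial t z) ` B"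
      unfolding p q using A B by (intro Max_in; simp)+
    then obtain s t where st: "s \<in> A" "t \<in> B"
      "p z = tropical_monomial s z" "q z = tropical_monomial t z"
      by auto
    then have "p z + q z = tropical_monomial (m (s, t)) z"
      by (simp add: m)
    then show "p z + q z \<in> (\<lambda>t. tropical_monomial t z) ` m ` (A \<times> B)"
      using st(1,2) by blast
  qed
  then show ?thesis
    unfolding tropical_polynomial_def using A B
    by (intro exI[of _ "m ` (A \<times> B)"]) auto
qed

lemma tropical_polynomial_max:
  fixes p q :: "real^'m::finite \<Rightarrow> real"
  assumes "tropical_polynomial p" "tropical_polynomial q"
  shows "tropical_polynomial (\<lambda>z. max (p z) (q z))"
proof -
  obtain A where A: "finite A" "A \<noteq> {}" and p: "p = (\<lambda>z. MAX t\<in>A. tropical_monomial t z)"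
    using assms(1) unfolding tropical_polynomial_def by blast
  obtain B where B: "finite B" "B \<noteq> {}" and q: "q = (\<lambda>z. MAX t\<in>B. tropical_monomial t z)"
    using assms(2) unfolding tropical_polynomial_def by blast
  have "max (p z) (q z) = (MAX t\<in>A \<union> B. tropical_monomial t z)" for z
    unfolding p q image_Un using A B by (simp add: Max_Un)
  then show ?thesis
    unfolding tropical_polynomial_def using A B by (intro exI[of _ "A \<union> B"]) auto
qed

lemma tropical_rational_of_polynomial:
  assumes "tropical_polynomial p"
  shows "tropical_rational p"
  unfolding tropical_rational_def
  using assms tropical_polynomial_const[of 0] by (intro exI[of _ p] exI[of _ "\<lambda>_. 0"]) simp

lemma tropical_rational_const: "tropical_rational (\<lambda>z. c)"
  by (intro tropical_rational_of_polynomial tropical_polynomial_const)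

lemma tropical_rational_coordinate: "tropical_rational (\<lambda>z. z $ i)"
  by (intro tropical_rational_of_polynomial tropical_polynomial_coordinate)

lemma tropical_rational_add:
  assumes "tropical_rational f" "tropical_rational g"
  shows "tropical_rational (\<lambda>z. f z + g z)"
proof -
  obtain p q p' q' where pq: "tropical_polynomial p" "tropical_polynomial q"
      "tropical_polynomial p'" "tropical_polynomial q'"
    and fg: "f = (\<lambda>z. p z - q z)" "g = (\<lambda>z. p' z - q' z)"
    using assms unfolding tropical_rational_def by blast
  have "(\<lambda>z. f z + g z) = (\<lambda>z. (p z + p' z) - (q z + q' z))"
    unfolding fg by (simp add: algebra_simps)
  then show ?thesis
    unfolding tropical_rational_def using pq tropical_polynomial_add by blast
qed

lemma tropical_rational_minus:
  assumes "tropical_rational f"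
  shows "tropical_rational (\<lambda>z. - f z)"
proof -
  obtain p q where pq: "tropical_polynomial p" "tropical_polynomial q"
    and f: "f = (\<lambda>z. p z - q z)"
    using assms unfolding tropical_rational_def by blast
  have "(\<lambda>z. - f z) = (\<lambda>z. q z - p z)"
    unfolding f by simp
  then show ?thesis
    unfolding tropical_rational_def using pq by blast
qed

lemma tropical_rational_diff:
  assumes "tropical_rational f" "tropical_rational g"
  shows "tropical_rational (\<lambda>z. f z - g z)"
  using tropical_rational_add[OF assms(1) tropical_rational_minus[OF assms(2)]] by simp

text \<open>Addition of tropical fractions: bring both to the common denominator \<open>q + q'\<close>.\<close>

lemma tropical_rational_max:
  assumes "tropical_rational f" "tropical_rational g"
  shows "tropical_rational (\<lambda>z. max (f z) (g z))"
proof -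
  obtain p q p' q' where pq: "tropical_polynomial p" "tropical_polynomial q"
      "tropical_polynomial p'" "tropical_polynomial q'"
    and fg: "f = (\<lambda>z. p z - q z)" "g = (\<lambda>z. p' z - q' z)"
    using assms unfolding tropical_rational_def by blast
  have "(\<lambda>z. max (f z) (g z)) = (\<lambda>z. max (p z + q' z) (p' z + q z) - (q z + q' z))"
    unfolding fg by (auto simp: max_def)
  moreover have "tropical_polynomial (\<lambda>z. max (p z + q' z) (p' z + q z))"
    by (intro tropical_polynomial_max tropical_polynomial_add pq)
  moreover have "tropical_polynomial (\<lambda>z. q z + q' z)"
    by (intro tropical_polynomial_add pq)
  ultimately show ?thesis
    unfolding tropical_rational_def by blast
qed

lemma tropical_rational_min:
  assumes "tropical_rational f" "tropical_rational g"
  shows "tropical_rational (\<lambda>z. min (f z) (g z))"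
proof -
  have "(\<lambda>z. min (f z) (g z)) = (\<lambda>z. - max (- f z) (- g z))"
    by (auto simp: min_def max_def)
  then show ?thesis
    using assms by (simp add: tropical_rational_minus tropical_rational_max)
qed

lemma tropical_rational_abs:
  assumes "tropical_rational f"
  shows "tropical_rational (\<lambda>z. \<bar>f z\<bar>)"
proof -
  have "(\<lambda>z. \<bar>f z\<bar>) = (\<lambda>z. max (f z) (- f z))"
    by (auto simp: max_def)
  then show ?thesis
    using assms by (simp add: tropical_rational_minus tropical_rational_max)
qed

text \<open>
  \<open>P\<close> is arbitrary because the tropical rational functions are one instance, and the property
  in the induction rule below is another.
\<close>

lemma Max_closed:
  fixes h :: "'a \<Rightarrow> 'b \<Rightarrow> 'c::linorder"
  assumes "finite A" "A \<noteq> {}" "\<And>a. a \<in> A \<Longrightarrow> P (h a)"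
    and max: "\<And>f g. P f \<Longrightarrow> P g \<Longrightarrow> P (\<lambda>z. max (f z) (g z))"
  shows "P (\<lambda>z. MAX a\<in>A. h a z)"
  using assms(1-3) by (induction rule: finite_ne_induct) (simp_all add: max)

lemma Min_closed:
  fixes h :: "'a \<Rightarrow> 'b \<Rightarrow> 'c::linorder"
  assumes "finite A" "A \<noteq> {}" "\<And>a. a \<in> A \<Longrightarrow> P (h a)"
    and min: "\<And>f g. P f \<Longrightarrow> P g \<Longrightarrow> P (\<lambda>z. min (f z) (g z))"
  shows "P (\<lambda>z. MIN a\<in>A. h a z)"
  using assms(1-3) by (induction rule: finite_ne_induct) (simp_all add: min)

lemma nat_multiple_closed:
  fixes f :: "'b \<Rightarrow> real"
  assumes "P (\<lambda>z. 0)" "P f"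
    and add: "\<And>f g. P f \<Longrightarrow> P g \<Longrightarrow> P (\<lambda>z. f z + g z)"
  shows "P (\<lambda>z. real n * f z)"
proof (induction n)
  case 0
  then show ?case using assms(1) by simp
next
  case (Suc n)
  then show ?case using add[OF assms(2) Suc] by (simp add: algebra_simps)
qed

lemma tropical_rational_int_multiple:
  assumes "tropical_rational f"
  shows "tropical_rational (\<lambda>z. of_int k * f z)"
proof (cases k)
  case (nonneg n)
  then show ?thesis
    using nat_multiple_closed[of tropical_rational f n] assms
    by (simp add: tropical_rational_const tropical_rational_add)
next
  case (neg n)
  have "real_of_int k = - real (Suc n)"
    unfolding neg by simp
  then have "(\<lambda>z. of_int k * f z) = (\<lambda>z. - (real (Suc n) * f z))"
    by (simp only: mult_minus_left)
  then show ?thesis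
    using nat_multiple_closed[of tropical_rational f "Suc n"] assms
      tropical_rational_minus[of "\<lambda>z. real (Suc n) * f z"]
    by (simp add: tropical_rational_const tropical_rational_add del: of_nat_Suc)
qed

text \<open>
  A tropical polynomial is built from constants and coordinates by finitely many sums and
  maxima, as its exponents are natural numbers. This rule replaces every later use of the
  monomial expansion.
\<close>

lemma tropical_rational_induct [consumes 1, case_names const coord add diff max]:
  fixes f :: "real^'m::finite \<Rightarrow> real"
  assumes f: "tropical_rational f"
    and const: "\<And>c. P (\<lambda>z. c)"
    and coord: "\<And>i. P (\<lambda>z. z $ i)"
    and add: "\<And>f g. P f \<Longrightarrow> P g \<Longrightarrow> P (\<lambda>z. f z + g z)"
    and diff: "\<And>f g. P f \<Longrightarrow> P g \<Longrightarrow> P (\<lambda>z. f z - g z)"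
    and max: "\<And>f g. P f \<Longrightarrow> P g \<Longrightarrow> P (\<lambda>z. max (f z) (g z))"
  shows "P f"
proof -
  have sum: "P (\<lambda>z. \<Sum>i\<in>I. real (a i) * z $ i)" if "finite I" for I a
    using that
  proof (induction I rule: finite_induct)
    case empty
    then show ?case using const by simp
  next
    case (insert i I)
    have "P (\<lambda>z. real (a i) * z $ i)"
      by (rule nat_multiple_closed) (use const coord add in auto)
    from add[OF this insert.IH] show ?case
      using insert.hyps by simp
  qed
  have "P (tropical_monomial t)" for t
    using add[OF const sum[OF finite_class.finite_UNIV, of "snd t"]]
    by (simp add: tropical_monomial_def[abs_def])
  then have "P p" if "tropical_polynomial p" for p
    using that Max_closed[of _ P tropical_monomial] max
    unfolding tropical_polynomial_def by blast
  then show ?thesis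
    using f diff unfolding tropical_rational_def by blast
qed

lemma tropical_rational_compose:
  assumes "tropical_rational f" "tropical_rational_map T"
  shows "tropical_rational (\<lambda>w. f (T w))"
  using assms(1)
proof (induction rule: tropical_rational_induct)
  case (coord i)
  then show ?case using assms(2) by (simp add: tropical_rational_map_def)
qed (simp_all add: tropical_rational_const tropical_rational_add tropical_rational_diff
      tropical_rational_max)

lemma tropical_rational_lipschitz:
  fixes f :: "real^'m::finite \<Rightarrow> real"
  assumes "tropical_rational f"
  shows "\<exists>L\<ge>0. \<forall>x y. \<bar>f x - f y\<bar> \<le> L * norm (x - y)"
  using assms
proof (induction rule: tropical_rational_induct)
  case (const c)
  show ?case by (rule exI[of _ 0]) simp
next
  case (coord i)
  have "\<bar>x $ i - y $ i\<bar> \<le> 1 * norm (x - y)" for x y :: "real^'m"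
    using component_le_norm_cart[of "x - y" i] by simp
  then show ?case using zero_le_one by blast
next
  case (add f g)
  then obtain L M where LM: "L \<ge> 0" "M \<ge> 0"
    "\<And>x y. \<bar>f x - f y\<bar> \<le> L * norm (x - y)" "\<And>x y. \<bar>g x - g y\<bar> \<le> M * norm (x - y)"
    by blast
  have "\<bar>(f x + g x) - (f y + g y)\<bar> \<le> (L + M) * norm (x - y)" for x y
    using LM(3,4)[of x y] unfolding distrib_right by linarith
  with LM(1,2) show ?case by (intro exI[of _ "L + M"]) simp
next
  case (diff f g)
  then obtain L M where LM: "L \<ge> 0" "M \<ge> 0"
    "\<And>x y. \<bar>f x - f y\<bar> \<le> L * norm (x - y)" "\<And>x y. \<bar>g x - g y\<bar> \<le> M * norm (x - y)"
    by blast
  have "\<bar>(f x - g x) - (f y - g y)\<bar> \<le> (L + M) * norm (x - y)" for x y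
    using LM(3,4)[of x y] unfolding distrib_right by linarith
  with LM(1,2) show ?case by (intro exI[of _ "L + M"]) simp
next
  case (max f g)
  then obtain L M where LM: "L \<ge> 0" "M \<ge> 0"
    "\<And>x y. \<bar>f x - f y\<bar> \<le> L * norm (x - y)" "\<And>x y. \<bar>g x - g y\<bar> \<le> M * norm (x - y)"
    by blast
  have "\<bar>max (f x) (g x) - max (f y) (g y)\<bar> \<le> (L + M) * norm (x - y)" for x y
    using LM(3,4)[of x y] unfolding distrib_right max_def by (auto split: if_splits)
  with LM(1,2) show ?case by (intro exI[of _ "L + M"]) simp
qed

section \<open>Invariant functions and the quotient metric\<close>

lemma orbit_dist_attained:
  assumes "G \<noteq> {}"
  obtains g where "g \<in> G" "orbit_dist G x y = norm (x - perm_act g y)"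
proof -
  have "orbit_dist G x y \<in> (\<lambda>g. norm (x - perm_act g y)) ` G"
    unfolding orbit_dist_def using assms by (intro Min_in) auto
  then show thesis using that by blast
qed

lemma orbit_dist_nonneg:
  assumes "G \<noteq> {}"
  shows "orbit_dist G x y \<ge> 0"
  by (metis assms norm_ge_zero orbit_dist_attained)

text \<open>
  The Lipschitz bound between \<open>x\<close> and the point of the orbit of \<open>y\<close> nearest to \<open>x\<close> is already
  the claim, since \<open>f\<close> does not see the move within the orbit.
\<close>

lemma invariant_lipschitz_orbit_dist:
  assumes "G \<noteq> {}" "tropical_rational f" "perm_invariant G f"
  shows "\<exists>L\<ge>0. \<forall>x y. \<bar>f x - f y\<bar> \<le> L * orbit_dist G x y"
proof -
  obtain L where L: "L \<ge> 0" "\<And>x y. \<bar>f x - f y\<bar> \<le> L * norm (x - y)"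
    using tropical_rational_lipschitz[OF assms(2)] by blast
  have "\<bar>f x - f y\<bar> \<le> L * orbit_dist G x y" for x y
  proof -
    obtain g where g: "g \<in> G" "orbit_dist G x y = norm (x - perm_act g y)"
      using orbit_dist_attained[OF assms(1)] .
    then have "f (perm_act g y) = f y"
      using assms(3) by (simp add: perm_invariant_def)
    then show ?thesis
      using L(2)[of x "perm_act g y"] g(2) by simp
  qed
  then show ?thesis using L(1) by blast
qed

lemma tuple_map_lipschitz_orbit_dist:
  fixes F :: "'k::finite \<Rightarrow> real ^ 'n::finite \<Rightarrow> real"
  assumes "G \<noteq> {}" "\<And>i. tropical_rational (F i)" "\<And>i. perm_invariant G (F i)"
  shows "\<exists>C>0. \<forall>x y. norm (tuple_map F x - tuple_map F y) \<le> C * orbit_dist G x y"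
proof -
  have "\<forall>i. \<exists>L\<ge>0. \<forall>x y. \<bar>F i x - F i y\<bar> \<le> L * orbit_dist G x y"
    using invariant_lipschitz_orbit_dist assms by blast
  then obtain L where L: "\<And>i. L i \<ge> 0" "\<And>i x y. \<bar>F i x - F i y\<bar> \<le> L i * orbit_dist G x y"
    by metis
  have "norm (tuple_map F x - tuple_map F y) \<le> ((\<Sum>i\<in>UNIV. L i) + 1) * orbit_dist G x y" for x y
  proof -
    have "norm (tuple_map F x - tuple_map F y) \<le> (\<Sum>i\<in>UNIV. \<bar>F i x - F i y\<bar>)"
      using norm_le_l1_cart[of "tuple_map F x - tuple_map F y"] by (simp add: tuple_map_def)
    also have "\<dots> \<le> (\<Sum>i\<in>UNIV. L i * orbit_dist G x y)"
      by (intro sum_mono L)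
    also have "\<dots> \<le> ((\<Sum>i\<in>UNIV. L i) + 1) * orbit_dist G x y"
      using orbit_dist_nonneg[OF assms(1)] by (simp add: sum_distrib_right distrib_right)
    finally show ?thesis .
  qed
  moreover have "(\<Sum>i\<in>UNIV. L i) + 1 > 0"
    using L(1) by (simp add: sum_nonneg add_nonneg_pos)
  ultimately show ?thesis by blast
qed

lemma id_in_permutation_group:
  assumes "subgroup G (BijGroup UNIV)"
  shows "id \<in> G"
proof -
  have "\<one>\<^bsub>BijGroup UNIV\<^esub> = (id :: 'a \<Rightarrow> 'a)"
    by (auto simp: BijGroup_def)
  then show ?thesis using subgroup.one_closed[OF assms] by simp
qed

lemma invariant_eq_on_orbit:
  assumes G: "subgroup G (BijGroup UNIV)" and f: "perm_invariant G f"
    and orbit: "perm_orbit G y = perm_orbit G x"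
  shows "f y = f x"
proof -
  have "perm_act id y = y"
    by (simp add: perm_act_def vec_eq_iff)
  then have "y \<in> perm_orbit G y"
    unfolding perm_orbit_def
    using imageI[OF id_in_permutation_group[OF G], of "\<lambda>g. perm_act g y"] by simp
  then have "y \<in> perm_orbit G x"
    using orbit by simp
  then obtain g where "g \<in> G" "y = perm_act g x"
    unfolding perm_orbit_def by blast
  then show ?thesis
    using f by (simp add: perm_invariant_def)
qed

section \<open>The minimum formula\<close>

lemma tropical_rational_defect:
  fixes F :: "'k::finite \<Rightarrow> real ^ 'n::finite \<Rightarrow> real"
  assumes "\<And>i. tropical_rational (F i)" "tropical_rational_map T"
  shows "tropical_rational (defect F T)"
proof -
  have "tropical_rational (\<lambda>w. MAX i\<in>UNIV. \<bar>w $ i - F i (T w)\<bar>)"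
    by (rule Max_closed[where P = tropical_rational])
      (auto intro!: tropical_rational_abs tropical_rational_diff tropical_rational_max
        tropical_rational_compose[OF assms] tropical_rational_coordinate)
  then show ?thesis by (simp add: defect_def[abs_def])
qed

lemma tropical_rational_min_formula:
  fixes F :: "'k::finite \<Rightarrow> real ^ 'n::finite \<Rightarrow> real"
  assumes "\<And>i. tropical_rational (F i)" "tropical_rational f" "finite J" "J \<noteq> {}"
    and "\<And>j. j \<in> J \<Longrightarrow> tropical_rational_map (T j)"
  shows "tropical_rational (min_formula F J T f \<kappa>)"
proof -
  have "tropical_rational (\<lambda>w. MIN j\<in>J. f (T j w) + of_int \<kappa> * defect F (T j) w)"
    by (rule Min_closed[where P = tropical_rational])
      (use assms in \<open>auto intro!: tropical_rational_min tropical_rational_add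
        tropical_rational_int_multiple tropical_rational_defect
        tropical_rational_compose[OF assms(2)]\<close>)
  then show ?thesis by (simp add: min_formula_def[abs_def])
qed

lemma norm_le_card_times_defect:
  fixes F :: "'k::finite \<Rightarrow> real ^ 'n::finite \<Rightarrow> real"
  shows "norm (w - tuple_map F (T w)) \<le> real CARD('k) * defect F T w"
proof -
  have "norm (w - tuple_map F (T w)) \<le> (\<Sum>i\<in>UNIV. \<bar>w $ i - F i (T w)\<bar>)"
    using norm_le_l1_cart[of "w - tuple_map F (T w)"] by (simp add: tuple_map_def)
  also have "\<dots> \<le> real CARD('k) * defect F T w"
    unfolding defect_def by (rule sum_bounded_above) simp
  finally show ?thesis .
qed

lemma defect_eq_0:
  assumes "w = tuple_map F (T w)"
  shows "defect F T w = 0"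
proof -
  have "w $ i = F i (T w)" for i
    using arg_cong[OF assms, of "\<lambda>v. v $ i"] by (simp add: tuple_map_def)
  then show ?thesis by (simp add: defect_def)
qed

text \<open>
  Exact penalty: the penalty \<open>\<kappa> D\<^sub>j\<close> outweighs the error \<open>L \<cdot> d\<close> of replacing \<open>x\<close> by
  \<open>T\<^sub>j (\<Phi> x)\<close>, and it vanishes at a \<open>j\<close> for which there is no error.
\<close>

lemma min_formula_tuple_map:
  fixes F :: "'k::finite \<Rightarrow> real ^ 'n::finite \<Rightarrow> real"
  assumes G: "subgroup G (BijGroup UNIV)"
    and F_invariant: "\<And>i. perm_invariant G (F i)"
    and c: "c > 0" "\<And>x y. c * orbit_dist G x y \<le> norm (tuple_map F x - tuple_map F y)"
    and J: "finite J"
    and T_section: "\<And>x. \<exists>j\<in>J. perm_orbit G (T j (tuple_map F x)) = perm_orbit G x"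
    and f_invariant: "perm_invariant G f"
    and L: "L \<ge> 0" "\<And>x y. \<bar>f x - f y\<bar> \<le> L * orbit_dist G x y"
    and \<kappa>: "of_int \<kappa> \<ge> L * real CARD('k) / c"
  shows "min_formula F J T f \<kappa> (tuple_map F x) = f x"
  unfolding min_formula_def
proof (rule Min_eqI)
  show "finite ((\<lambda>j. f (T j (tuple_map F x)) + of_int \<kappa> * defect F (T j) (tuple_map F x)) ` J)"
    using J by simp
next
  fix v assume "v \<in> (\<lambda>j. f (T j (tuple_map F x)) + of_int \<kappa> * defect F (T j) (tuple_map F x)) ` J"
  then obtain j where v: "v = f (T j (tuple_map F x)) + of_int \<kappa> * defect F (T j) (tuple_map F x)"
    by blast
  define y where "y = T j (tuple_map F x)"
  define D where "D = defect F (T j) (tuple_map F x)"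
  have norm: "norm (tuple_map F x - tuple_map F y) \<le> real CARD('k) * D"
    unfolding y_def D_def by (rule norm_le_card_times_defect)
  then have "0 \<le> real CARD('k) * D"
    using norm_ge_zero order_trans by blast
  then have D: "D \<ge> 0"
    by (simp add: zero_le_mult_iff)
  have "orbit_dist G x y \<le> real CARD('k) * D / c"
    using order_trans[OF c(2) norm] c(1) by (simp add: pos_le_divide_eq mult.commute)
  then have "L * orbit_dist G x y \<le> L * (real CARD('k) * D / c)"
    using L(1) by (rule mult_left_mono)
  also have "\<dots> = (L * real CARD('k) / c) * D"
    by simp
  also have "\<dots> \<le> of_int \<kappa> * D"
    using \<kappa> D by (rule mult_right_mono)
  finally show "f x \<le> v"
    using L(2)[of x y] unfolding v y_def[symmetric] D_def[symmetric] by linarith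
next
  obtain j where j: "j \<in> J" "perm_orbit G (T j (tuple_map F x)) = perm_orbit G x"
    using T_section by blast
  have "F i (T j (tuple_map F x)) = F i x" for i
    using invariant_eq_on_orbit[OF G F_invariant j(2)] .
  then have "tuple_map F x = tuple_map F (T j (tuple_map F x))"
    by (simp add: tuple_map_def)
  then have "defect F (T j) (tuple_map F x) = 0"
    by (rule defect_eq_0)
  moreover have "f (T j (tuple_map F x)) = f x"
    using invariant_eq_on_orbit[OF G f_invariant j(2)] .
  ultimately have "f x = f (T j (tuple_map F x)) + of_int \<kappa> * defect F (T j) (tuple_map F x)"
    by simp
  then show "f x \<in> (\<lambda>j. f (T j (tuple_map F x)) + of_int \<kappa> * defect F (T j) (tuple_map F x)) ` J"
    using j(1) by blast
qed

theorem theorem4p1: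
  fixes G :: "('n::finite \<Rightarrow> 'n) set"
    and F :: "'k::finite \<Rightarrow> real ^ 'n \<Rightarrow> real"
    and J :: "'j set"
    and T :: "'j \<Rightarrow> real ^ 'k \<Rightarrow> real ^ 'n"
  assumes G: "subgroup G (BijGroup UNIV)"
    and F_rational: "\<And>i. tropical_rational (F i)"
    and F_invariant: "\<And>i. perm_invariant G (F i)"
    and S_separates: "separates_orbits G (tuple_map F)"
    and S_lower: "\<exists>c>0. \<forall>x y. norm (tuple_map F x - tuple_map F y) \<ge> c * orbit_dist G x y"
    and J_finite: "finite J"
    and T_rational: "\<And>j. j \<in> J \<Longrightarrow> tropical_rational_map (T j)"
    and T_section: "\<And>x. \<exists>j\<in>J. perm_orbit G (T j (tuple_map F x)) = perm_orbit G x"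
  shows "(\<exists>C>0. \<forall>x y. norm (tuple_map F x - tuple_map F y) \<le> C * orbit_dist G x y)
    \<and> generates_invariants G F
    \<and> (\<forall>f. tropical_rational f \<and> perm_invariant G f \<longrightarrow>
         (\<exists>\<kappa>\<^sub>0::int. \<forall>\<kappa>\<ge>\<kappa>\<^sub>0. tropical_rational (min_formula F J T f \<kappa>)
            \<and> f = min_formula F J T f \<kappa> \<circ> tuple_map F))"
proof -
  have G_ne: "G \<noteq> {}"
    using id_in_permutation_group[OF G] by blast
  have J_ne: "J \<noteq> {}"
    using T_section by blast
  obtain c where c: "c > 0"
    "\<And>x y. c * orbit_dist G x y \<le> norm (tuple_map F x - tuple_map F y)"
    using S_lower by blast
  have formula: "\<exists>\<kappa>\<^sub>0::int. \<forall>\<kappa>\<ge>\<kappa>\<^sub>0. tropical_rational (min_formula F J T f \<kappa>)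
      \<and> f = min_formula F J T f \<kappa> \<circ> tuple_map F"
    if f: "tropical_rational f" "perm_invariant G f" for f
  proof -
    obtain L where L: "L \<ge> 0" "\<And>x y. \<bar>f x - f y\<bar> \<le> L * orbit_dist G x y"
      using invariant_lipschitz_orbit_dist[OF G_ne f] by blast
    have "tropical_rational (min_formula F J T f \<kappa>) \<and> f = min_formula F J T f \<kappa> \<circ> tuple_map F"
      if "\<kappa> \<ge> \<lceil>L * real CARD('k) / c\<rceil>" for \<kappa>
    proof
      show "tropical_rational (min_formula F J T f \<kappa>)"
        using F_rational f(1) J_finite J_ne T_rational by (rule tropical_rational_min_formula)
      have "of_int \<kappa> \<ge> L * real CARD('k) / c"
        using that by (simp add: ceiling_le_iff)
      then have "min_formula F J T f \<kappa> (tuple_map F x) = f x" for x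
        using min_formula_tuple_map[OF G F_invariant c J_finite T_section f(2) L] by blast
      then show "f = min_formula F J T f \<kappa> \<circ> tuple_map F"
        by (simp add: fun_eq_iff)
    qed
    then show ?thesis by blast
  qed
  then have "generates_invariants G F"
    unfolding generates_invariants_def by (meson order_refl)
  moreover have "\<exists>C>0. \<forall>x y. norm (tuple_map F x - tuple_map F y) \<le> C * orbit_dist G x y"
    using G_ne F_rational F_invariant by (rule tuple_map_lipschitz_orbit_dist)
  ultimately show ?thesis
    using formula by blast
qed

end
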